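(* Fix $\alpha\in[0,1]$. If $Z_1,\dots,Z_{n+1}$ are exchangeable, where $Z_i=(X_i,Y_i)$, then the modified randomly-localized conformal prediction set $$\mathcal{C}(X_{n+1})=\bigg\{y\in\mathcal{Y}:S^y_{n+1}\le\mathrm{Quantile}_{1-\alpha}\bigg(\frac{\sum_{i=1}^{n+1}\bar H_{iK}\,\delta_{S^y_i}}{\sum_{i=1}^{n+1}\bar H_{iK}}\bigg)\bigg\}$$ satisfies the marginal coverage guarantee $$\mathbb{P}\{Y_{n+1}\in\mathcal{C}(X_{n+1})\}\ge1-\alpha.$$
   Context: $\mathcal{X},\mathcal{Y}$ are measurable spaces, $\mathcal{Z}=\mathcal{X}\times\mathcal{Y}$, $n\ge1$, and all functions are measurable. Exchangeable means that the joint distribution of $(Z_1,\dots,Z_{n+1})$ is invariant under permutations. $H:\mathcal{X}\times\mathcal{X}\to[0,\infty)$ is a kernel such that for every $x\in\mathcal{X}$, $H(x,\cdot)$ is a density with respect to some base measure on $\mathcal{X}$, and $H(x,x)>0$. For $i,k\in\{1,\dots,n+1\}$ let $$\bar H_{ik}=\frac{H(X_i,X_k)}{\sum_{j=1}^{n+1}H(X_i,X_j)}.$$ The random index $K\in\{1,\dots,n+1\}$ is sampled given the features by $K\mid X_1,\dots,X_{n+1}\sim\sum_{k=1}^{n+1}\bar H_{n+1,k}\,\delta_k$; the sampling uses only the features, i.e. this is also the conditional distribution of $K$ given $Z_1,\dots,Z_{n+1}$. A score function $\mathsf{s}((x,y),\mathrm{bag}(z))\in\mathbb{R}$ is fixed;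 it assigns a real value to a point $(x,y)\in\mathcal{Z}$ given the unordered multiset $\mathrm{bag}(z)$ of the entries of a dataset $z\in\mathcal{Z}^{n+1}$ (so it is invariant to permutations of $z$). For $y\in\mathcal{Y}$, let $Z^y=(Z_1,\dots,Z_n,(X_{n+1},y))$ with $i$th entry $Z^y_i$, and $S^y_i=\mathsf{s}(Z^y_i,\mathrm{bag}(Z^y))$, $i=1,\dots,n+1$. $\delta_v$ is the point mass at $v$, and $\mathrm{Quantile}_\tau(P)=\inf\{x\in\mathbb{R}:\mathbb{P}_{V\sim P}\{V\le x\}\ge\tau\}$. The probability in the claim is over the data and $K$. *)

theory Defs
  imports "HOL-Probability.Probability"
begin

definition exchangeable ::
  "'w measure \<Rightarrow> 'z measure \<Rightarrow> 'i set \<Rightarrow> ('i \<Rightarrow> 'w \<Rightarrow> 'z) \<Rightarrow> bool"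
where
  "exchangeable M N I Z \<longleftrightarrow>
     (\<forall>p. p permutes I \<longrightarrow>
        distr M (\<Pi>\<^sub>M i\<in>I. N) (\<lambda>\<omega>. \<lambda>i\<in>I. Z (p i) \<omega>) =
        distr M (\<Pi>\<^sub>M i\<in>I. N) (\<lambda>\<omega>. \<lambda>i\<in>I. Z i \<omega>))"

text \<open>The base measure is quantified after the point x, so it may depend on x; kernels that are
  densities with respect to one common base measure are a special case.\<close>

definition localization_kernel :: "'x measure \<Rightarrow> ('x \<Rightarrow> 'x \<Rightarrow> real) \<Rightarrow> bool"
where
  "localization_kernel MX H \<longleftrightarrow>
     (\<lambda>(x, x'). H x x') \<in> borel_measurable (MX \<Otimes>\<^sub>M MX) \<and>
     (\<forall>x\<in>space MX. \<forall>x'\<in>space MX. 0 \<le> H x x') \<and>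
     (\<forall>x\<in>space MX. \<exists>\<nu>. sets \<nu> = sets MX \<and> prob_space (density \<nu> (\<lambda>x'. ennreal (H x x')))) \<and>
     (\<forall>x\<in>space MX. 0 < H x x)"

definition Hbar :: "nat \<Rightarrow> ('x \<Rightarrow> 'x \<Rightarrow> real) \<Rightarrow> (nat \<Rightarrow> 'x) \<Rightarrow> nat \<Rightarrow> nat \<Rightarrow> real"
where
  "Hbar n H x i k = H (x i) (x k) / (\<Sum>j = 1..n+1. H (x i) (x j))"

text \<open>Conditionally on the random element T with values in N, the random index K takes the
  value k with probability p k, for each k in I (an almost sure statement, as usual).\<close>

definition cond_index_law ::
  "'w measure \<Rightarrow> 't measure \<Rightarrow> ('w \<Rightarrow> 't) \<Rightarrow> 'i set \<Rightarrow> ('w \<Rightarrow> 'i) \<Rightarrow> ('w \<Rightarrow> 'i \<Rightarrow> real) \<Rightarrow> bool"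
where
  "cond_index_law M N T I K p \<longleftrightarrow>
     (\<forall>k\<in>I. AE \<omega> in M.
        real_cond_exp M (vimage_algebra (space M) T N)
          (indicator {\<omega> \<in> space M. K \<omega> = k}) \<omega> = p \<omega> k)"

text \<open>The value is an extended real: at level 0 the infimum is over all of the reals.\<close>

definition Quantile :: "real \<Rightarrow> real measure \<Rightarrow> ereal"
where
  "Quantile \<tau> P = Inf (ereal ` {x. \<tau> \<le> measure P {..x}})"

text \<open>The mixture of the point masses at v i with weights proportional to w i, as the law of
  v i for an index i drawn from the normalized weights.\<close>

definition weighted_point_masses ::
  "'i set \<Rightarrow> ('i \<Rightarrow> real) \<Rightarrow> ('i \<Rightarrow> real) \<Rightarrow> real measure"
where
  "weighted_point_masses I w v =
     distr (point_measure I (\<lambda>i. ennreal (w i / (\<Sum>j\<in>I. w j)))) borel v"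

lemma measure_weighted_point_masses:
  assumes "finite I" and "\<And>i. i \<in> I \<Longrightarrow> 0 \<le> w i" and "A \<in> sets borel"
  shows "measure (weighted_point_masses I w v) A =
    (\<Sum>i | i \<in> I \<and> v i \<in> A. w i) / (\<Sum>i\<in>I. w i)"
proof -
  have S: "0 \<le> (\<Sum>j\<in>I. w j)"
    using assms(2) by (intro sum_nonneg) auto
  have nn: "0 \<le> w i / (\<Sum>j\<in>I. w j)" if "i \<in> I" for i
    using assms(2)[OF that] S by (rule divide_nonneg_nonneg)
  have m: "v \<in> measurable (point_measure I (\<lambda>i. ennreal (w i / (\<Sum>j\<in>I. w j)))) borel"
    by (simp add: measurable_def space_point_measure sets_point_measure)
  have "measure (weighted_point_masses I w v) A =
      measure (point_measure I (\<lambda>i. ennreal (w i / (\<Sum>j\<in>I. w j)))) (v -` A \<inter> I)"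
    unfolding weighted_point_masses_def
    using measure_distr[OF m assms(3)] by (simp add: space_point_measure)
  also have "v -` A \<inter> I = {i \<in> I. v i \<in> A}"
    by auto
  also have "measure (point_measure I (\<lambda>i. ennreal (w i / (\<Sum>j\<in>I. w j)))) {i \<in> I. v i \<in> A} =
      (\<Sum>i | i \<in> I \<and> v i \<in> A. w i / (\<Sum>j\<in>I. w j))"
  proof -
    have "(\<Sum>i | i \<in> I \<and> v i \<in> A. ennreal (w i / (\<Sum>j\<in>I. w j))) =
        ennreal (\<Sum>i | i \<in> I \<and> v i \<in> A. w i / (\<Sum>j\<in>I. w j))"
      by (intro sum_ennreal nn) auto
    moreover have "0 \<le> (\<Sum>i | i \<in> I \<and> v i \<in> A. w i / (\<Sum>j\<in>I. w j))"
      by (intro sum_nonneg nn) auto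
    ultimately show ?thesis
      using assms(1) by (simp add: measure_def emeasure_point_measure_finite2)
  qed
  finally show ?thesis
    by (simp add: sum_divide_distrib)
qed

definition bag :: "nat \<Rightarrow> (nat \<Rightarrow> 'z) \<Rightarrow> 'z multiset"
where
  "bag n z = image_mset z (mset_set {1..n+1})"

text \<open>Measurability of the score is that of the map sending a point and a dataset to the score
  of the point given the bag of the dataset.\<close>

definition measurable_score :: "nat \<Rightarrow> 'z measure \<Rightarrow> ('z \<Rightarrow> 'z multiset \<Rightarrow> real) \<Rightarrow> bool"
where
  "measurable_score n N s \<longleftrightarrow>
     (\<lambda>(p, z). s p (bag n z)) \<in> borel_measurable (N \<Otimes>\<^sub>M (\<Pi>\<^sub>M i\<in>{1..n+1}. N))"

definition augmented :: "nat \<Rightarrow> (nat \<Rightarrow> 'x) \<Rightarrow> (nat \<Rightarrow> 'y) \<Rightarrow> 'y \<Rightarrow> nat \<Rightarrow> 'x \<times> 'y"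
where
  "augmented n x y y' i = (if i = n+1 then (x (n+1), y') else (x i, y i))"

definition score ::
  "nat \<Rightarrow> ('x \<times> 'y \<Rightarrow> ('x \<times> 'y) multiset \<Rightarrow> real) \<Rightarrow>
   (nat \<Rightarrow> 'x) \<Rightarrow> (nat \<Rightarrow> 'y) \<Rightarrow> 'y \<Rightarrow> nat \<Rightarrow> real"
where
  "score n s x y y' i = s (augmented n x y y' i) (bag n (augmented n x y y'))"

text \<open>The entry y (n+1) is never read: every y' in the set is judged by the dataset in which
  the last response is replaced by y'.\<close>

definition prediction_set ::
  "'y measure \<Rightarrow> nat \<Rightarrow> real \<Rightarrow> ('x \<Rightarrow> 'x \<Rightarrow> real) \<Rightarrow>
   ('x \<times> 'y \<Rightarrow> ('x \<times> 'y) multiset \<Rightarrow> real) \<Rightarrow>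
   (nat \<Rightarrow> 'x) \<Rightarrow> (nat \<Rightarrow> 'y) \<Rightarrow> nat \<Rightarrow> 'y set"
where
  "prediction_set MY n \<alpha> H s x y k =
     {y' \<in> space MY.
        ereal (score n s x y y' (n+1)) \<le>
        Quantile (1 - \<alpha>)
          (weighted_point_masses {1..n+1} (\<lambda>i. Hbar n H x i k) (score n s x y y'))}"

end

theory Submission
  imports Defs
begin

text \<open>
  Call the j-th data point covered at index k if its score does not exceed the quantile of the
  scores weighted by the k-th column of the matrix \<open>Hbar\<close>. The rows of \<open>Hbar\<close> sum to one, and
  row \<open>n+1\<close> is the law of \<open>K\<close>; the quantile, however, uses a column. The two are reconciled by
  averaging over all data points.

  Conditionally on the data, the test point is covered with probability
  \<open>\<Sum>k. Hbar (n+1) k * [n+1 is covered at k]\<close> (\<open>prob_conditional_index\<close>). This is the value at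
  \<open>j = n+1\<close> of a function \<open>row_coverage\<close> of the dataset and of \<open>j\<close> in which permuting the dataset
  only permutes \<open>j\<close>, since scores see the dataset only as a bag (\<open>row_coverage_permute\<close>). By
  exchangeability its expectation therefore does not depend on \<open>j\<close>, and it equals the average
  over \<open>j\<close>. For every fixed dataset that average is at least \<open>1 - \<alpha>\<close>: exchange the sums over
  \<open>j\<close> and \<open>k\<close>; for fixed \<open>k\<close>, the indices whose value lies at or below the \<open>(1 - \<alpha>)\<close>-quantile
  of a weighted sample carry at least a fraction \<open>1 - \<alpha>\<close> of the weight
  (\<open>weight_of_values_up_to_quantile\<close>), so column \<open>k\<close> contributes at least \<open>1 - \<alpha>\<close> times its sum,
  and the column sums add up to the sum \<open>n+1\<close> of all rows (\<open>sum_row_coverage_ge\<close>).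
\<close>

section \<open>Quantiles of weighted samples\<close>

text \<open>The distribution function of a finite sample is a step function, so the levels attained
  strictly left of \<open>t\<close> include the limit from the left, which is attained at the largest value
  below \<open>t\<close>. The criterion refers to finite sums only, which makes coverage a measurable event.\<close>

lemma le_Quantile_weighted_iff:
  assumes "finite I" and w: "\<And>i. i \<in> I \<Longrightarrow> 0 \<le> w i"
  shows "ereal t \<le> Quantile \<tau> (weighted_point_masses I w v) \<longleftrightarrow>
    (\<Sum>i | i \<in> I \<and> v i < t. w i) / (\<Sum>i\<in>I. w i) < \<tau>"
proof -
  define c where "c x = (\<Sum>i | i \<in> I \<and> v i \<le> x. w i) / (\<Sum>i\<in>I. w i)" for x
  define b where "b = (\<Sum>i | i \<in> I \<and> v i < t. w i) / (\<Sum>i\<in>I. w i)"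
  have c: "measure (weighted_point_masses I w v) {..x} = c x" for x
    using measure_weighted_point_masses[OF assms, where A = "{..x}" and v = v] by (simp add: c_def)
  have total: "0 \<le> (\<Sum>i\<in>I. w i)"
    using w by (intro sum_nonneg)
  have left: "c x \<le> b" if "x < t" for x
    unfolding c_def b_def using that w \<open>finite I\<close>
    by (intro divide_right_mono sum_mono2 total) auto
  have attained: "\<exists>x<t. b \<le> c x"
  proof (cases "{i \<in> I. v i < t} = {}")
    case True
    then have "b = 0"
      by (simp only: b_def) simp
    moreover have "0 \<le> c (t - 1)"
      unfolding c_def using w total by (intro divide_nonneg_nonneg sum_nonneg) auto
    ultimately show ?thesis
      by (intro exI[of _ "t - 1"]) auto
  next
    case False
    define m where "m = Max (v ` {i \<in> I. v i < t})"
    have "m \<in> v ` {i \<in> I. v i < t}"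
      unfolding m_def using False \<open>finite I\<close> by (intro Max_in) auto
    then have "m < t"
      by auto
    moreover have "v i \<le> m" if "i \<in> I" "v i < t" for i
      unfolding m_def using that \<open>finite I\<close> by (intro Max_ge) auto
    then have "b \<le> c m"
      unfolding b_def c_def using w \<open>finite I\<close>
      by (intro divide_right_mono sum_mono2 total) auto
    ultimately show ?thesis
      by blast
  qed
  have "ereal t \<le> Quantile \<tau> (weighted_point_masses I w v) \<longleftrightarrow> (\<forall>x. \<tau> \<le> c x \<longrightarrow> t \<le> x)"
    unfolding Quantile_def c by (simp add: le_Inf_iff)
  also have "\<dots> \<longleftrightarrow> b < \<tau>"
    using left attained by (meson not_le order_trans)
  finally show ?thesis
    by (simp add: b_def)
qed

text \<open>If some value is above the quantile, take the smallest such value: all values strictly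
  below it are at most the quantile, and together they already carry the weight \<open>\<tau>\<close>.\<close>

lemma weight_of_values_up_to_quantile:
  fixes w v :: "'i \<Rightarrow> real"
  assumes "finite I" and w: "\<And>i. i \<in> I \<Longrightarrow> 0 \<le> w i" and "\<tau> \<le> 1"
  defines "below t \<equiv> (\<Sum>i | i \<in> I \<and> v i < t. w i) / (\<Sum>i\<in>I. w i)"
  shows "\<tau> * (\<Sum>i\<in>I. w i) \<le> (\<Sum>j\<in>I. w j * of_bool (below (v j) < \<tau>))"
proof -
  define J where "J = {j \<in> I. \<not> below (v j) < \<tau>}"
  have total: "0 \<le> (\<Sum>i\<in>I. w i)"
    using w by (intro sum_nonneg)
  show ?thesis
  proof (cases "J = {}")
    case True
    then have "(\<Sum>j\<in>I. w j * of_bool (below (v j) < \<tau>)) = (\<Sum>j\<in>I. w j)"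
      by (intro sum.cong) (auto simp: J_def)
    then show ?thesis
      using mult_right_mono[OF \<open>\<tau> \<le> 1\<close> total] by simp
  next
    case False
    have "finite J"
      using \<open>finite I\<close> by (simp add: J_def)
    then obtain j where j: "j \<in> J" "\<And>i. i \<in> J \<Longrightarrow> v j \<le> v i"
      using False by (metis arg_min_if_finite(1) arg_min_least)
    have "\<tau> * (\<Sum>i\<in>I. w i) \<le> (\<Sum>i | i \<in> I \<and> v i < v j. w i)"
    proof (cases "(\<Sum>i\<in>I. w i) = 0")
      case True
      then show ?thesis
        using w by (auto intro!: sum_nonneg)
    next
      case False
      then show ?thesis
        using j(1) total by (simp add: J_def below_def not_less pos_le_divide_eq)
    qed
    also have "\<dots> = (\<Sum>i\<in>I. if v i < v j then w i else 0)"
      using \<open>finite I\<close> by (rule sum.inter_filter)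
    also have "\<dots> \<le> (\<Sum>i\<in>I. w i * of_bool (below (v i) < \<tau>))"
    proof (rule sum_mono)
      fix i assume "i \<in> I"
      then show "(if v i < v j then w i else 0) \<le> w i * of_bool (below (v i) < \<tau>)"
        using w[of i] j(2)[of i] by (auto simp: J_def)
    qed
    finally show ?thesis .
  qed
qed

section \<open>Exchangeable families and conditionally sampled indices\<close>

lemma exchangeable_integral_eq:
  fixes f :: "('i \<Rightarrow> 'z) \<Rightarrow> real"
  assumes "exchangeable M N I Z" and "p permutes I"
    and Z: "\<And>i. i \<in> I \<Longrightarrow> Z i \<in> measurable M N"
    and f: "f \<in> borel_measurable (\<Pi>\<^sub>M i\<in>I. N)"
  shows "(\<integral>\<omega>. f (\<lambda>i\<in>I. Z (p i) \<omega>) \<partial>M) = (\<integral>\<omega>. f (\<lambda>i\<in>I. Z i \<omega>) \<partial>M)"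
proof -
  have m: "(\<lambda>\<omega>. \<lambda>i\<in>I. Z i \<omega>) \<in> measurable M (\<Pi>\<^sub>M i\<in>I. N)"
    using Z by (intro measurable_restrict)
  have mp: "(\<lambda>\<omega>. \<lambda>i\<in>I. Z (p i) \<omega>) \<in> measurable M (\<Pi>\<^sub>M i\<in>I. N)"
    using Z permutes_in_image[OF \<open>p permutes I\<close>] by (intro measurable_restrict) auto
  show ?thesis
    using assms(1,2) integral_distr[OF m f] integral_distr[OF mp f]
    by (simp add: exchangeable_def)
qed

text \<open>The tower property: on each event \<open>K = k\<close> the remaining condition depends on \<open>T\<close> alone, so
  the indicator of \<open>K = k\<close> may be replaced by its conditional expectation given \<open>T\<close>.\<close>

lemma prob_conditional_index:
  assumes "prob_space M" and "finite I"
    and T: "T \<in> measurable M N" and K: "K \<in> measurable M (count_space I)"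
    and law: "cond_index_law M N T I K q"
    and q: "\<And>k. k \<in> I \<Longrightarrow> (\<lambda>\<omega>. q \<omega> k) \<in> borel_measurable M"
    and A: "\<And>k. k \<in> I \<Longrightarrow> A k \<in> sets N"
  shows "measure M {\<omega> \<in> space M. T \<omega> \<in> A (K \<omega>)} =
    (\<Sum>k\<in>I. \<integral>\<omega>. q \<omega> k * indicator (A k) (T \<omega>) \<partial>M)"
proof -
  interpret prob_space M by fact
  let ?F = "vimage_algebra (space M) T N"
  have TF: "T \<in> measurable ?F N"
    using T by (intro measurable_vimage_algebra1) (auto dest: measurable_space)
  have sub: "subalgebra M ?F"
  proof -
    have "T \<in> space M \<rightarrow> space N"
      using T by (auto dest: measurable_space)
    then show ?thesis
      using measurable_sets[OF T] by (auto simp: subalgebra_def sets_vimage_algebra2)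
  qed
  interpret finite_measure_subalgebra M ?F
    by unfold_locales (rule sub)
  have KI: "K \<omega> \<in> I" if "\<omega> \<in> space M" for \<omega>
    using measurable_space[OF K that] by simp
  define E where "E k = {\<omega> \<in> space M. K \<omega> = k}" for k
  define D where "D k = {\<omega> \<in> space M. T \<omega> \<in> A k}" for k
  have E: "E k \<in> sets M" if "k \<in> I" for k
    using measurable_sets[OF K, of "{k}"] that
    by (simp add: E_def vimage_def Int_def conj_commute)
  have D: "D k \<in> sets M" if "k \<in> I" for k
    using measurable_sets[OF T A[OF that]]
    by (simp add: D_def vimage_def Int_def conj_commute)
  have "{\<omega> \<in> space M. T \<omega> \<in> A (K \<omega>)} = (\<Union>k\<in>I. E k \<inter> D k)"
    using KI by (auto simp: E_def D_def)
  then have "measure M {\<omega> \<in> space M. T \<omega> \<in> A (K \<omega>)} = measure M (\<Union>k\<in>I. E k \<inter> D k)"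
    by simp
  also have "\<dots> = (\<Sum>k\<in>I. measure M (E k \<inter> D k))"
    using \<open>finite I\<close> E D
    by (intro finite_measure_finite_Union) (auto simp: disjoint_family_on_def E_def)
  also have "\<dots> = (\<Sum>k\<in>I. \<integral>\<omega>. q \<omega> k * indicator (A k) (T \<omega>) \<partial>M)"
  proof (rule sum.cong[OF refl])
    fix k assume k: "k \<in> I"
    note [measurable] = A[OF k] E[OF k] D[OF k] q[OF k] T
    have "measure M (E k \<inter> D k) = (\<integral>\<omega>. indicator (E k \<inter> D k) \<omega> \<partial>M)"
      using E[OF k] D[OF k] by simp
    also have "\<dots> = (\<integral>\<omega>. indicator (A k) (T \<omega>) * indicator (E k) \<omega> \<partial>M)"
      by (intro Bochner_Integration.integral_cong) (auto simp: D_def split: split_indicator)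
    also have "\<dots> = (\<integral>\<omega>. indicator (A k) (T \<omega>) * real_cond_exp M ?F (indicator (E k)) \<omega> \<partial>M)"
    proof (rule real_cond_exp_intg(2)[symmetric])
      show "(\<lambda>\<omega>. indicator (A k) (T \<omega>)) \<in> borel_measurable ?F"
        by (rule measurable_compose[OF TF]) simp
      show "integrable M (\<lambda>\<omega>. indicator (A k) (T \<omega>) * (indicator (E k) \<omega> :: real))"
        by (rule integrable_const_bound[where B = 1]) (auto split: split_indicator)
    qed simp
    also have "\<dots> = (\<integral>\<omega>. q \<omega> k * indicator (A k) (T \<omega>) \<partial>M)"
    proof (rule integral_cong_AE)
      have "AE \<omega> in M. real_cond_exp M ?F (indicator (E k)) \<omega> = q \<omega> k"
        using law k by (simp add: cond_index_law_def E_def)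
      then show "AE \<omega> in M. indicator (A k) (T \<omega>) * real_cond_exp M ?F (indicator (E k)) \<omega> =
          q \<omega> k * indicator (A k) (T \<omega>)"
        by eventually_elim simp
    qed simp_all
    finally show "measure M (E k \<inter> D k) = \<dots>" .
  qed
  finally show ?thesis .
qed

section \<open>The localization weights\<close>

lemma Hbar_cong:
  assumes "\<And>i. i \<in> {1..n+1} \<Longrightarrow> x i = x' i" and "i \<in> {1..n+1}" and "k \<in> {1..n+1}"
  shows "Hbar n H x i k = Hbar n H x' i k"
proof -
  have "(\<Sum>j = 1..n+1. H (x i) (x j)) = (\<Sum>j = 1..n+1. H (x' i) (x' j))"
    using assms by (intro sum.cong) auto
  then show ?thesis
    using assms by (simp add: Hbar_def)
qed

lemma Hbar_nonneg:
  assumes "localization_kernel MX H" and "\<And>i. i \<in> {1..n+1} \<Longrightarrow> x i \<in> space MX"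
    and "i \<in> {1..n+1}" and "k \<in> {1..n+1}"
  shows "0 \<le> Hbar n H x i k"
  unfolding Hbar_def using assms
  by (intro divide_nonneg_nonneg sum_nonneg) (auto simp: localization_kernel_def)

lemma sum_Hbar_row:
  assumes "localization_kernel MX H" and x: "\<And>i. i \<in> {1..n+1} \<Longrightarrow> x i \<in> space MX"
    and "i \<in> {1..n+1}"
  shows "(\<Sum>k = 1..n+1. Hbar n H x i k) = 1"
proof -
  have "0 < (\<Sum>j = 1..n+1. H (x i) (x j))"
    using assms by (intro sum_pos2[of _ i]) (auto simp: localization_kernel_def)
  then show ?thesis
    unfolding Hbar_def sum_divide_distrib[symmetric] by simp
qed

lemma Hbar_permute:
  assumes "p permutes {1..n+1}"
  shows "Hbar n H (\<lambda>i. x (p i)) i k = Hbar n H x (p i) (p k)"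
  using sum.permute[OF assms, of "\<lambda>j. H (x (p i)) (x j)"] by (simp add: Hbar_def o_def)

section \<open>Coverage of a data point as a function of the dataset\<close>

abbreviation feature_weight ::
  "nat \<Rightarrow> ('x \<Rightarrow> 'x \<Rightarrow> real) \<Rightarrow> (nat \<Rightarrow> 'x \<times> 'y) \<Rightarrow> nat \<Rightarrow> nat \<Rightarrow> real"
where
  "feature_weight n H z \<equiv> Hbar n H (\<lambda>i. fst (z i))"

text \<open>By \<open>le_Quantile_weighted_iff\<close> this says that the score of point \<open>j\<close> is at most the
  \<open>\<tau>\<close>-quantile of the scores weighted by column \<open>k\<close>.\<close>

definition covered ::
  "nat \<Rightarrow> real \<Rightarrow> ('x \<Rightarrow> 'x \<Rightarrow> real) \<Rightarrow> ('x \<times> 'y \<Rightarrow> ('x \<times> 'y) multiset \<Rightarrow> real) \<Rightarrow>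
   (nat \<Rightarrow> 'x \<times> 'y) \<Rightarrow> nat \<Rightarrow> nat \<Rightarrow> bool"
where
  "covered n \<tau> H s z j k \<longleftrightarrow>
     (\<Sum>i | i \<in> {1..n+1} \<and> s (z i) (bag n z) < s (z j) (bag n z). feature_weight n H z i k) /
     (\<Sum>i = 1..n+1. feature_weight n H z i k) < \<tau>"

text \<open>The conditional probability, given the dataset, that point \<open>j\<close> is covered at an index drawn
  from row \<open>j\<close> of the weights.\<close>

definition row_coverage ::
  "nat \<Rightarrow> real \<Rightarrow> ('x \<Rightarrow> 'x \<Rightarrow> real) \<Rightarrow> ('x \<times> 'y \<Rightarrow> ('x \<times> 'y) multiset \<Rightarrow> real) \<Rightarrow>
   (nat \<Rightarrow> 'x \<times> 'y) \<Rightarrow> nat \<Rightarrow> real"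
where
  "row_coverage n \<tau> H s z j =
     (\<Sum>k = 1..n+1. feature_weight n H z j k * of_bool (covered n \<tau> H s z j k))"

lemma bag_cong:
  assumes "\<And>i. i \<in> {1..n+1} \<Longrightarrow> z i = z' i"
  shows "bag n z = bag n z'"
  unfolding bag_def using assms by (intro image_mset_cong) simp

lemma bag_permute:
  assumes "p permutes {1..n+1}"
  shows "bag n (\<lambda>i. z (p i)) = bag n z"
proof -
  have "image_mset p (mset_set {1..n+1}) = mset_set {1..n+1}"
    using image_mset_mset_set[of p "{1..n+1}"] permutes_inj_on[OF assms]
      permutes_image[OF assms] by simp
  then show ?thesis
    unfolding bag_def by (metis (no_types, lifting) comp_apply image_mset_cong multiset.map_comp)
qed

lemma covered_cong:
  assumes z: "\<And>i. i \<in> {1..n+1} \<Longrightarrow> z i = z' i" and "j \<in> {1..n+1}" and "k \<in> {1..n+1}"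
  shows "covered n \<tau> H s z j k = covered n \<tau> H s z' j k"
proof -
  have w: "feature_weight n H z i k = feature_weight n H z' i k" if "i \<in> {1..n+1}" for i
    using assms that by (intro Hbar_cong) auto
  have "(\<Sum>i | i \<in> {1..n+1} \<and> s (z i) (bag n z) < s (z j) (bag n z). feature_weight n H z i k) =
      (\<Sum>i | i \<in> {1..n+1} \<and> s (z' i) (bag n z') < s (z' j) (bag n z'). feature_weight n H z' i k)"
    by (rule sum.cong) (use assms w bag_cong[OF z] in auto)
  moreover have "(\<Sum>i = 1..n+1. feature_weight n H z i k) =
      (\<Sum>i = 1..n+1. feature_weight n H z' i k)"
    by (rule sum.cong) (use w in auto)
  ultimately show ?thesis
    by (simp add: covered_def)
qed

lemma row_coverage_cong:
  assumes "\<And>i. i \<in> {1..n+1} \<Longrightarrow> z i = z' i" and "j \<in> {1..n+1}"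
  shows "row_coverage n \<tau> H s z j = row_coverage n \<tau> H s z' j"
  unfolding row_coverage_def
proof (rule sum.cong[OF refl])
  fix k assume k: "k \<in> {1..n+1}"
  have "feature_weight n H z j k = feature_weight n H z' j k"
    by (rule Hbar_cong) (use assms k in auto)
  moreover have "covered n \<tau> H s z j k = covered n \<tau> H s z' j k"
    by (rule covered_cong) (use assms k in auto)
  ultimately show "feature_weight n H z j k * of_bool (covered n \<tau> H s z j k) =
      feature_weight n H z' j k * of_bool (covered n \<tau> H s z' j k)"
    by simp
qed

lemma covered_permute:
  assumes p: "p permutes {1..n+1}"
  shows "covered n \<tau> H s (\<lambda>i. z (p i)) j k = covered n \<tau> H s z (p j) (p k)"
proof -
  let ?S = "\<lambda>i. s (z i) (bag n z)" and ?W = "\<lambda>i. feature_weight n H z i (p k)"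
  have num: "(\<Sum>i | i \<in> {1..n+1} \<and> ?S (p i) < ?S (p j). ?W (p i)) =
      (\<Sum>i | i \<in> {1..n+1} \<and> ?S i < ?S (p j). ?W i)"
    using sum.permute[OF p, of "\<lambda>i. if ?S i < ?S (p j) then ?W i else 0"]
    by (simp only: sum.inter_filter[OF finite_atLeastAtMost] o_def)
  have den: "(\<Sum>i = 1..n+1. ?W (p i)) = (\<Sum>i = 1..n+1. ?W i)"
    using sum.permute[OF p, of ?W] by (simp only: o_def)
  show ?thesis
    unfolding covered_def bag_permute[OF p, where z = z]
      Hbar_permute[OF p, where x = "\<lambda>i. fst (z i)"] num den ..
qed

lemma row_coverage_permute:
  assumes p: "p permutes {1..n+1}"
  shows "row_coverage n \<tau> H s (\<lambda>i. z (p i)) j = row_coverage n \<tau> H s z (p j)"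
proof -
  let ?g = "\<lambda>k. feature_weight n H z (p j) k * of_bool (covered n \<tau> H s z (p j) k)"
  have "row_coverage n \<tau> H s (\<lambda>i. z (p i)) j = (\<Sum>k = 1..n+1. ?g (p k))"
    unfolding row_coverage_def
    by (rule sum.cong[OF refl])
      (simp only: covered_permute[OF p, where z = z] Hbar_permute[OF p, where x = "\<lambda>i. fst (z i)"])
  also have "\<dots> = (\<Sum>k = 1..n+1. ?g k)"
    using sum.permute[OF p, of ?g] by (simp only: o_def)
  finally show ?thesis
    unfolding row_coverage_def .
qed

text \<open>Summing over the points turns the row weights of each index \<open>k\<close> into the column weights that
  define its quantile.\<close>

lemma sum_row_coverage_ge:
  fixes z :: "nat \<Rightarrow> 'x \<times> 'y"
  assumes H: "localization_kernel MX H" and "\<tau> \<le> 1"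
    and z: "\<And>i. i \<in> {1..n+1} \<Longrightarrow> fst (z i) \<in> space MX"
  shows "\<tau> * real (n + 1) \<le> (\<Sum>j = 1..n+1. row_coverage n \<tau> H s z j)"
proof -
  let ?W = "feature_weight n H z"
  have "(\<Sum>k = 1..n+1. \<Sum>j = 1..n+1. ?W j k) = (\<Sum>j = 1..n+1. \<Sum>k = 1..n+1. ?W j k)"
    by (rule sum.swap)
  also have "\<dots> = (\<Sum>j = 1..n+1. 1)"
    using sum_Hbar_row[OF H, of n "\<lambda>i. fst (z i)"] z by (intro sum.cong) auto
  finally have "\<tau> * real (n + 1) = (\<Sum>k = 1..n+1. \<tau> * (\<Sum>j = 1..n+1. ?W j k))"
    by (simp add: sum_distrib_left[symmetric])
  also have "\<dots> \<le> (\<Sum>k = 1..n+1. \<Sum>j = 1..n+1. ?W j k * of_bool (covered n \<tau> H s z j k))"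
    unfolding covered_def
    by (intro sum_mono weight_of_values_up_to_quantile
        Hbar_nonneg[OF H, of n "\<lambda>i. fst (z i)"] z \<open>\<tau> \<le> 1\<close>) auto
  also have "\<dots> = (\<Sum>j = 1..n+1. row_coverage n \<tau> H s z j)"
    unfolding row_coverage_def by (rule sum.swap)
  finally show ?thesis .
qed

lemma measurable_feature_weight:
  assumes "localization_kernel MX H" and i: "i \<in> {1..n+1}" and k: "k \<in> {1..n+1}"
  shows "(\<lambda>z. feature_weight n H z i k) \<in> borel_measurable (\<Pi>\<^sub>M i\<in>{1..n+1}. MX \<Otimes>\<^sub>M MY)"
proof -
  have H: "(\<lambda>(x, x'). H x x') \<in> borel_measurable (MX \<Otimes>\<^sub>M MX)"
    using assms(1) by (simp add: localization_kernel_def)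
  have feature: "(\<lambda>z. fst (z a)) \<in> measurable (\<Pi>\<^sub>M i\<in>{1..n+1}. MX \<Otimes>\<^sub>M MY) MX"
    if "a \<in> {1..n+1}" for a
    by (rule measurable_compose[OF _ measurable_fst]) (rule measurable_component_singleton[OF that])
  have "(\<lambda>z. H (fst (z a)) (fst (z b))) \<in> borel_measurable (\<Pi>\<^sub>M i\<in>{1..n+1}. MX \<Otimes>\<^sub>M MY)"
    if "a \<in> {1..n+1}" "b \<in> {1..n+1}" for a b
    using measurable_compose[OF measurable_Pair[OF feature[OF that(1)] feature[OF that(2)]] H]
    by simp
  then show ?thesis
    unfolding Hbar_def using i k
    by (intro borel_measurable_divide borel_measurable_sum) auto
qed

lemma measurable_dataset_score:
  assumes "measurable_score n N s" and "i \<in> {1..n+1}"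
  shows "(\<lambda>z. s (z i) (bag n z)) \<in> borel_measurable (\<Pi>\<^sub>M i\<in>{1..n+1}. N)"
proof -
  have s: "(\<lambda>(p, z). s p (bag n z)) \<in> borel_measurable (N \<Otimes>\<^sub>M (\<Pi>\<^sub>M i\<in>{1..n+1}. N))"
    using assms(1) by (simp add: measurable_score_def)
  have "(\<lambda>z. (z i, z)) \<in> measurable (\<Pi>\<^sub>M i\<in>{1..n+1}. N) (N \<Otimes>\<^sub>M (\<Pi>\<^sub>M i\<in>{1..n+1}. N))"
    using assms(2) by (intro measurable_Pair measurable_component_singleton) auto
  from measurable_compose[OF this s] show ?thesis
    by simp
qed

lemma covered_sets:
  assumes H: "localization_kernel MX H" and s: "measurable_score n (MX \<Otimes>\<^sub>M MY) s"
    and j: "j \<in> {1..n+1}" and k: "k \<in> {1..n+1}"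
  shows "{z \<in> space (\<Pi>\<^sub>M i\<in>{1..n+1}. MX \<Otimes>\<^sub>M MY). covered n \<tau> H s z j k}
    \<in> sets (\<Pi>\<^sub>M i\<in>{1..n+1}. MX \<Otimes>\<^sub>M MY)"
proof -
  have "(\<lambda>z. (\<Sum>i = 1..n+1. if s (z i) (bag n z) < s (z j) (bag n z)
      then feature_weight n H z i k else 0)) \<in> borel_measurable (\<Pi>\<^sub>M i\<in>{1..n+1}. MX \<Otimes>\<^sub>M MY)"
    by (intro borel_measurable_sum measurable_If borel_measurable_less
        measurable_dataset_score[OF s] measurable_feature_weight[OF H] j k) auto
  moreover have "(\<lambda>z. (\<Sum>i = 1..n+1. feature_weight n H z i k))
      \<in> borel_measurable (\<Pi>\<^sub>M i\<in>{1..n+1}. MX \<Otimes>\<^sub>M MY)"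
    by (intro borel_measurable_sum measurable_feature_weight[OF H] k)
  ultimately show ?thesis
    unfolding covered_def sum.inter_filter[OF finite_atLeastAtMost]
    by (intro borel_measurable_less borel_measurable_divide borel_measurable_const)
qed

lemma measurable_row_coverage:
  assumes H: "localization_kernel MX H" and s: "measurable_score n (MX \<Otimes>\<^sub>M MY) s"
    and j: "j \<in> {1..n+1}"
  shows "(\<lambda>z. row_coverage n \<tau> H s z j) \<in> borel_measurable (\<Pi>\<^sub>M i\<in>{1..n+1}. MX \<Otimes>\<^sub>M MY)"
  unfolding row_coverage_def of_bool_def
  by (intro borel_measurable_sum borel_measurable_times measurable_feature_weight[OF H j]
      measurable_If covered_sets[OF H s j]) auto

lemma row_coverage_bounds:
  assumes H: "localization_kernel MX H" and z: "\<And>i. i \<in> {1..n+1} \<Longrightarrow> fst (z i) \<in> space MX"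
    and j: "j \<in> {1..n+1}"
  shows "0 \<le> row_coverage n \<tau> H s z j" and "row_coverage n \<tau> H s z j \<le> 1"
proof -
  have w: "0 \<le> feature_weight n H z j k" if "k \<in> {1..n+1}" for k
    by (rule Hbar_nonneg[OF H]) (use z j that in auto)
  show "0 \<le> row_coverage n \<tau> H s z j"
    unfolding row_coverage_def using w by (intro sum_nonneg) auto
  have "row_coverage n \<tau> H s z j \<le> (\<Sum>k = 1..n+1. feature_weight n H z j k)"
    unfolding row_coverage_def using w by (intro sum_mono) auto
  also have "\<dots> = 1"
    by (rule sum_Hbar_row[OF H]) (use z j in auto)
  finally show "row_coverage n \<tau> H s z j \<le> 1" .
qed

text \<open>The response tried by the prediction set is the observed one, so the augmented dataset is the
  dataset itself.\<close>

lemma observed_mem_prediction_set_iff: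
  assumes H: "localization_kernel MX H"
    and x: "\<And>i. i \<in> {1..n+1} \<Longrightarrow> x i \<in> space MX" and "y (n+1) \<in> space MY"
    and k: "k \<in> {1..n+1}"
  shows "y (n+1) \<in> prediction_set MY n \<alpha> H s x y k \<longleftrightarrow>
    covered n (1 - \<alpha>) H s (\<lambda>i. (x i, y i)) (n+1) k"
proof -
  have "augmented n x y (y (n+1)) = (\<lambda>i. (x i, y i))"
    by (auto simp: augmented_def)
  then have "score n s x y (y (n+1)) = (\<lambda>i. s (x i, y i) (bag n (\<lambda>i. (x i, y i))))"
    by (auto simp: score_def)
  moreover have "0 \<le> Hbar n H x i k" if "i \<in> {1..n+1}" for i
    by (rule Hbar_nonneg[OF H]) (use x k that in auto)
  ultimately show ?thesis
    using \<open>y (n+1) \<in> space MY\<close>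
    by (simp only: prediction_set_def covered_def mem_Collect_eq fst_conv simp_thms
        le_Quantile_weighted_iff finite_atLeastAtMost)
qed

section \<open>Marginal coverage\<close>

theorem theorem13:
  fixes M :: "'w measure" and MX :: "'x measure" and MY :: "'y measure"
    and X :: "nat \<Rightarrow> 'w \<Rightarrow> 'x" and Y :: "nat \<Rightarrow> 'w \<Rightarrow> 'y" and K :: "'w \<Rightarrow> nat"
    and H :: "'x \<Rightarrow> 'x \<Rightarrow> real"
    and s :: "'x \<times> 'y \<Rightarrow> ('x \<times> 'y) multiset \<Rightarrow> real"
    and n :: nat and \<alpha> :: real
  assumes "prob_space M" and "1 \<le> n" and "0 \<le> \<alpha>" and "\<alpha> \<le> 1"
    and "\<And>i. i \<in> {1..n+1} \<Longrightarrow> X i \<in> measurable M MX"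
    and "\<And>i. i \<in> {1..n+1} \<Longrightarrow> Y i \<in> measurable M MY"
    and "exchangeable M (MX \<Otimes>\<^sub>M MY) {1..n+1} (\<lambda>i \<omega>. (X i \<omega>, Y i \<omega>))"
    and "localization_kernel MX H"
    and "measurable_score n (MX \<Otimes>\<^sub>M MY) s"
    and "K \<in> measurable M (count_space {1..n+1})"
    and "cond_index_law M (\<Pi>\<^sub>M i\<in>{1..n+1}. MX) (\<lambda>\<omega>. \<lambda>i\<in>{1..n+1}. X i \<omega>)
           {1..n+1} K (\<lambda>\<omega> k. Hbar n H (\<lambda>i. X i \<omega>) (n+1) k)"
    and "cond_index_law M (\<Pi>\<^sub>M i\<in>{1..n+1}. MX \<Otimes>\<^sub>M MY) (\<lambda>\<omega>. \<lambda>i\<in>{1..n+1}. (X i \<omega>, Y i \<omega>))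
           {1..n+1} K (\<lambda>\<omega> k. Hbar n H (\<lambda>i. X i \<omega>) (n+1) k)"
  shows "measure M {\<omega> \<in> space M.
           Y (n+1) \<omega> \<in> prediction_set MY n \<alpha> H s (\<lambda>i. X i \<omega>) (\<lambda>i. Y i \<omega>) (K \<omega>)} \<ge> 1 - \<alpha>"
proof -
  interpret prob_space M by fact
  note H = assms(8) and s = assms(9)
  define I where "I = {1..n+1}"
  define \<tau> where "\<tau> = 1 - \<alpha>"
  define Z where "Z = (\<lambda>i \<omega>. (X i \<omega>, Y i \<omega>))"
  define D where "D = (\<lambda>\<omega>. \<lambda>i\<in>I. Z i \<omega>)"
  define A where "A k = {z \<in> space (\<Pi>\<^sub>M i\<in>I. MX \<Otimes>\<^sub>M MY). covered n \<tau> H s z (n+1) k}" for k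
  let ?N = "\<Pi>\<^sub>M i\<in>I. MX \<Otimes>\<^sub>M MY"
  let ?R = "\<lambda>j \<omega>. row_coverage n \<tau> H s (D \<omega>) j"
  have last: "n + 1 \<in> I"
    by (simp add: I_def)
  have X: "X i \<omega> \<in> space MX" if "i \<in> I" "\<omega> \<in> space M" for i \<omega>
    using assms(5)[of i] that by (auto simp: I_def dest: measurable_space)
  have Z: "Z i \<in> measurable M (MX \<Otimes>\<^sub>M MY)" if "i \<in> I" for i
    unfolding Z_def using assms(5,6)[of i] that by (intro measurable_Pair) (auto simp: I_def)
  have D: "D \<in> measurable M ?N"
    unfolding D_def using Z by (intro measurable_restrict)
  have KI: "K \<omega> \<in> I" if "\<omega> \<in> space M" for \<omega>
    using measurable_space[OF assms(10) that] by (simp add: I_def)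
  have weight: "Hbar n H (\<lambda>i. X i \<omega>) (n+1) k = feature_weight n H (D \<omega>) (n+1) k"
    if "k \<in> I" for k \<omega>
    by (rule Hbar_cong) (use that last in \<open>auto simp: D_def Z_def I_def\<close>)
  have R_meas: "?R j \<in> borel_measurable M" if "j \<in> I" for j
    using measurable_compose[OF D] measurable_row_coverage[OF H s, of j \<tau>] that
    by (simp add: I_def)
  have DX: "fst (D \<omega> i) \<in> space MX" if "\<omega> \<in> space M" "i \<in> {1..n+1}" for \<omega> i
    using X that by (simp add: D_def Z_def I_def)
  have R_int: "integrable M (?R j)" if "j \<in> I" for j
  proof (rule integrable_const_bound[where B = 1])
    show "AE \<omega> in M. norm (?R j \<omega>) \<le> 1"
    proof (rule AE_I2)
      fix \<omega> assume "\<omega> \<in> space M"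
      then show "norm (?R j \<omega>) \<le> 1"
        using row_coverage_bounds[OF H, of n "D \<omega>" j \<tau> s] DX that by (simp add: I_def)
    qed
  qed (rule R_meas[OF that])

  \<comment> \<open>The transposition of \<open>j\<close> and \<open>n+1\<close> preserves the law of the data and moves point \<open>j\<close>
    into the test position.\<close>
  have R_exch: "(\<integral>\<omega>. ?R j \<omega> \<partial>M) = (\<integral>\<omega>. ?R (n+1) \<omega> \<partial>M)" if j: "j \<in> I" for j
  proof -
    define p where "p = Transposition.transpose j (n+1)"
    have p: "p permutes I"
      unfolding p_def using j last by (rule permutes_swap_id)
    have "(\<integral>\<omega>. ?R (n+1) \<omega> \<partial>M) =
        (\<integral>\<omega>. row_coverage n \<tau> H s (\<lambda>i\<in>I. Z (p i) \<omega>) (n+1) \<partial>M)"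
      unfolding D_def
    proof (rule exchangeable_integral_eq[OF _ p Z, symmetric])
      show "exchangeable M (MX \<Otimes>\<^sub>M MY) I Z"
        using assms(7) by (simp add: I_def Z_def)
      show "(\<lambda>z. row_coverage n \<tau> H s z (n+1)) \<in> borel_measurable ?N"
        using measurable_row_coverage[OF H s, of "n+1" \<tau>] by (simp add: I_def)
    qed
    also have "\<dots> = (\<integral>\<omega>. ?R j \<omega> \<partial>M)"
    proof (rule Bochner_Integration.integral_cong[OF refl])
      fix \<omega>
      have "row_coverage n \<tau> H s (\<lambda>i\<in>I. Z (p i) \<omega>) (n+1) =
          row_coverage n \<tau> H s (\<lambda>i. D \<omega> (p i)) (n+1)"
        by (rule row_coverage_cong)
          (use permutes_in_image[OF p] in \<open>auto simp: D_def I_def\<close>)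
      also have "\<dots> = ?R (p (n+1)) \<omega>"
        by (rule row_coverage_permute) (use p in \<open>simp add: I_def\<close>)
      finally show "row_coverage n \<tau> H s (\<lambda>i\<in>I. Z (p i) \<omega>) (n+1) = ?R j \<omega>"
        by (simp add: p_def)
    qed
    finally show ?thesis ..
  qed

  have "real (n + 1) * \<tau> = (\<integral>\<omega>. \<tau> * real (n + 1) \<partial>M)"
    by (simp add: prob_space)
  also have "\<dots> \<le> (\<integral>\<omega>. (\<Sum>j\<in>I. ?R j \<omega>) \<partial>M)"
  proof (rule integral_mono)
    fix \<omega> assume "\<omega> \<in> space M"
    then show "\<tau> * real (n + 1) \<le> (\<Sum>j\<in>I. ?R j \<omega>)"
      unfolding I_def using DX assms(3) by (intro sum_row_coverage_ge[OF H]) (auto simp: \<tau>_def)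
  qed (use R_int in auto)
  also have "\<dots> = (\<Sum>j\<in>I. \<integral>\<omega>. ?R j \<omega> \<partial>M)"
    using R_int by (intro Bochner_Integration.integral_sum) auto
  also have "\<dots> = (\<Sum>j\<in>I. \<integral>\<omega>. ?R (n+1) \<omega> \<partial>M)"
    using R_exch by (rule sum.cong[OF refl])
  also have "\<dots> = real (n + 1) * (\<integral>\<omega>. ?R (n+1) \<omega> \<partial>M)"
    by (simp add: I_def)
  finally have lower: "\<tau> \<le> (\<integral>\<omega>. ?R (n+1) \<omega> \<partial>M)"
    by (rule mult_left_le_imp_le) simp

  have q: "(\<lambda>\<omega>. feature_weight n H (D \<omega>) (n+1) k) \<in> borel_measurable M" if "k \<in> I" for k
    using measurable_compose[OF D] measurable_feature_weight[OF H, of "n+1" n k MY] that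
    by (simp add: I_def)
  have A: "A k \<in> sets ?N" if "k \<in> I" for k
    using covered_sets[OF H s, of "n+1" k \<tau>] that by (simp add: A_def I_def)
  have "{\<omega> \<in> space M. Y (n+1) \<omega> \<in> prediction_set MY n \<alpha> H s (\<lambda>i. X i \<omega>) (\<lambda>i. Y i \<omega>) (K \<omega>)} =
      {\<omega> \<in> space M. D \<omega> \<in> A (K \<omega>)}"
  proof (rule Collect_cong, rule conj_cong[OF refl])
    fix \<omega> assume \<omega>: "\<omega> \<in> space M"
    have "Y (n+1) \<omega> \<in> space MY"
      using assms(6)[of "n+1"] \<omega> by (auto dest: measurable_space)
    then have "Y (n+1) \<omega> \<in> prediction_set MY n \<alpha> H s (\<lambda>i. X i \<omega>) (\<lambda>i. Y i \<omega>) (K \<omega>) \<longleftrightarrow>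
        covered n \<tau> H s (\<lambda>i. Z i \<omega>) (n+1) (K \<omega>)"
      unfolding Z_def \<tau>_def
      using X[OF _ \<omega>] KI[OF \<omega>]
        observed_mem_prediction_set_iff[OF H, of n "\<lambda>i. X i \<omega>" "\<lambda>i. Y i \<omega>" MY "K \<omega>" \<alpha> s]
      by (simp add: I_def)
    also have "\<dots> \<longleftrightarrow> covered n \<tau> H s (D \<omega>) (n+1) (K \<omega>)"
      by (rule covered_cong) (use KI[OF \<omega>] in \<open>auto simp: D_def I_def\<close>)
    also have "\<dots> \<longleftrightarrow> D \<omega> \<in> A (K \<omega>)"
      using measurable_space[OF D \<omega>] by (simp add: A_def)
    finally show "Y (n+1) \<omega> \<in> prediction_set MY n \<alpha> H s (\<lambda>i. X i \<omega>) (\<lambda>i. Y i \<omega>) (K \<omega>) \<longleftrightarrow>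
        D \<omega> \<in> A (K \<omega>)" .
  qed
  then have "measure M {\<omega> \<in> space M.
      Y (n+1) \<omega> \<in> prediction_set MY n \<alpha> H s (\<lambda>i. X i \<omega>) (\<lambda>i. Y i \<omega>) (K \<omega>)} =
      measure M {\<omega> \<in> space M. D \<omega> \<in> A (K \<omega>)}"
    by simp
  also have "\<dots> = (\<Sum>k\<in>I. \<integral>\<omega>. feature_weight n H (D \<omega>) (n+1) k * indicator (A k) (D \<omega>) \<partial>M)"
  proof (rule prob_conditional_index[OF assms(1) _ D _ _ q A])
    show "cond_index_law M ?N D I K (\<lambda>\<omega> k. feature_weight n H (D \<omega>) (n+1) k)"
      using assms(12) weight by (simp add: cond_index_law_def D_def Z_def I_def)
    show "K \<in> measurable M (count_space I)"
      using assms(10) by (simp add: I_def)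
  qed (simp add: I_def)
  also have "\<dots> = (\<integral>\<omega>. (\<Sum>k\<in>I. feature_weight n H (D \<omega>) (n+1) k * indicator (A k) (D \<omega>)) \<partial>M)"
  proof (rule Bochner_Integration.integral_sum[symmetric])
    fix k assume k: "k \<in> I"
    note [measurable] = q[OF k] D A[OF k]
    show "integrable M (\<lambda>\<omega>. feature_weight n H (D \<omega>) (n+1) k * indicator (A k) (D \<omega>))"
    proof (rule integrable_const_bound[where B = 1])
      show "AE \<omega> in M. norm (feature_weight n H (D \<omega>) (n+1) k * indicator (A k) (D \<omega>)) \<le> 1"
      proof (rule AE_I2)
        fix \<omega> assume "\<omega> \<in> space M"
        note DX = DX[OF this]
        have nonneg: "0 \<le> feature_weight n H (D \<omega>) (n+1) l" if "l \<in> {1..n+1}" for l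
          by (rule Hbar_nonneg[OF H]) (use DX that in auto)
        have "feature_weight n H (D \<omega>) (n+1) k \<le> (\<Sum>l = 1..n+1. feature_weight n H (D \<omega>) (n+1) l)"
          using k nonneg by (intro member_le_sum) (auto simp: I_def)
        also have "\<dots> = 1"
          by (rule sum_Hbar_row[OF H]) (use DX in auto)
        finally show "norm (feature_weight n H (D \<omega>) (n+1) k * indicator (A k) (D \<omega>)) \<le> 1"
          using nonneg k by (auto simp: I_def split: split_indicator)
      qed
    qed measurable
  qed
  also have "\<dots> = (\<integral>\<omega>. ?R (n+1) \<omega> \<partial>M)"
  proof (rule Bochner_Integration.integral_cong[OF refl])
    fix \<omega> assume "\<omega> \<in> space M"
    then show "(\<Sum>k\<in>I. feature_weight n H (D \<omega>) (n+1) k * indicator (A k) (D \<omega>)) = ?R (n+1) \<omega>"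
      unfolding row_coverage_def I_def[symmetric] using measurable_space[OF D]
      by (intro sum.cong) (auto simp: A_def split: split_indicator)
  qed
  finally show ?thesis
    using lower by (simp add: \<tau>_def)
qed

end
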